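(* Consider a monotone covering instance and the randomized greedy algorithm (defined in the context). Suppose the algorithm terminates, and in each call $\mathrm{rstep}(x,S)$ the step size satisfies $\beta\le\min\{\mathbb E[c(x\uparrow_p\hat x)-c(x)]:\hat x\ge x,\ \hat x\in S\}$, where $p=(p_j)_{j\in\mathrm{vars}(S)}$ are the probabilities fixed in that call and $x\uparrow_p\hat x$ is the random vector obtained from $x$ by raising, for each $j\in\mathrm{vars}(S)$, $x_j$ to $\hat x_j$ with probability $p_j$ (the raise events having the same joint distribution as the events used in the call). Then the returned $x$ is feasible and $\mathbb E[c(x)]\le\Delta\cdot\mathrm{OPT}$.
   Context: A monotone covering instance consists of a collection $\mathcal C$ of monotone (closed upwards componentwise) subsets of $\mathbb R_+^n$ and a non-decreasing submodular cost $c:\mathbb R_+^n\to\mathbb R_+$ (i.e. $c(x)+c(y)\ge c(x\wedge y)+c(x\vee y)$, componentwise min/max). A vector is feasible if it lies in every $S\in\mathcal C$; $\mathrm{OPT}$ is the infimum cost of a feasible vector. $\mathrm{vars}(S)$ is the set of coordinates $S$ depends on and $\Delta=\max_S|\mathrm{vars}(S)|$. The randomized greedy algorithm: start with $x=\mathbf 0$; while some $S\in\mathcal C$ has $x\notin S$, pick such an $S$ and perform $\mathrm{rstep}(x,S)$: fix arbitrary probabilities $p_j\in[0,1]$ for $j\in\mathrm{vars}(S)$; choose a step size $\beta\ge0$; for each $j\in\mathrm{vars}(S)$ with $p_j>0$ let $X_j$ be the largest value such that raising only $x_j$ to $X_j$ would increase $c(x)$ by at most $\beta/p_j$; then for each such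 $j$, with probability $p_j$ set $x_j\leftarrow X_j$ (these events may be dependent). When all constraints are satisfied, return $x$.
   Formalization: Two assumptions are added, since the claim fails without them: the cost c is right-continuous in each coordinate separately, and either Δ ≥ 1 or c(0) = 0. *)

theory Defs
  imports "HOL-Probability.Probability"
begin

definition monotone_set :: "(real ^ 'n::finite) set \<Rightarrow> bool" where
  "monotone_set S \<longleftrightarrow> S \<subseteq> {x. 0 \<le> x} \<and> (\<forall>x\<in>S. \<forall>y. x \<le> y \<longrightarrow> y \<in> S)"

definition submodular :: "(real ^ 'n::finite \<Rightarrow> real) \<Rightarrow> bool" where
  "submodular c \<longleftrightarrow> (\<forall>x y. 0 \<le> x \<longrightarrow> 0 \<le> y \<longrightarrow> c x + c y \<ge> c (inf x y) + c (sup x y))"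

definition monotone_covering :: "(real ^ 'n::finite) set set \<Rightarrow> (real ^ 'n \<Rightarrow> real) \<Rightarrow> bool" where
  "monotone_covering C c \<longleftrightarrow>
     (\<forall>S\<in>C. monotone_set S) \<and>
     (\<forall>x. 0 \<le> x \<longrightarrow> 0 \<le> c x) \<and>
     (\<forall>x y. 0 \<le> x \<longrightarrow> x \<le> y \<longrightarrow> c x \<le> c y) \<and>
     submodular c"

definition feasible :: "(real ^ 'n::finite) set set \<Rightarrow> real ^ 'n \<Rightarrow> bool" where
  "feasible C x \<longleftrightarrow> 0 \<le> x \<and> (\<forall>S\<in>C. x \<in> S)"

definition OPT :: "(real ^ 'n::finite) set set \<Rightarrow> (real ^ 'n \<Rightarrow> real) \<Rightarrow> real" where
  "OPT C c = Inf (c ` {x. feasible C x})"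

definition vars :: "(real ^ 'n::finite) set \<Rightarrow> 'n set" where
  "vars S = {j. \<exists>x y. 0 \<le> x \<and> 0 \<le> y \<and> (\<forall>i. i \<noteq> j \<longrightarrow> x $ i = y $ i) \<and> x \<in> S \<and> y \<notin> S}"

(* The cardinalities are bounded by the dimension, so for nonempty C this supremum is a maximum
   even if C is infinite; for C = {} it is 0. *)
definition Delta :: "(real ^ 'n::finite) set set \<Rightarrow> nat" where
  "Delta C = (SUP S\<in>C. card (vars S))"

definition set_coord :: "real ^ 'n::finite \<Rightarrow> 'n \<Rightarrow> real \<Rightarrow> real ^ 'n" where
  "set_coord x j v = (\<chi> i. if i = j then v else x $ i)"

definition raise_to :: "real ^ 'n::finite \<Rightarrow> real ^ 'n \<Rightarrow> 'n set \<Rightarrow> real ^ 'n" where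
  "raise_to x y A = (\<chi> j. if j \<in> A then y $ j else x $ j)"

definition largest_raise ::
    "(real ^ 'n::finite \<Rightarrow> real) \<Rightarrow> real ^ 'n \<Rightarrow> 'n \<Rightarrow> real \<Rightarrow> real \<Rightarrow> bool" where
  "largest_raise c x j b X \<longleftrightarrow>
     x $ j \<le> X \<and> c (set_coord x j X) - c x \<le> b \<and>
     (\<forall>v. x $ j \<le> v \<and> c (set_coord x j v) - c x \<le> b \<longrightarrow> v \<le> X)"

(* The choices made in one call of rstep. The raise events need not be independent: raise_dist is
   the joint law of the random set of coordinates that are raised. *)
record 'n rcall =
  constr :: "(real ^ 'n) set"
  prob :: "'n \<Rightarrow> real"
  raise_dist :: "'n set pmf"
  stepsize :: real

definition raise_target ::
    "(real ^ 'n::finite \<Rightarrow> real) \<Rightarrow> real ^ 'n \<Rightarrow> 'n rcall \<Rightarrow> real ^ 'n" where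
  "raise_target c x r = (\<chi> j. THE X. largest_raise c x j (stepsize r / prob r j) X)"

definition valid_call ::
    "(real ^ 'n::finite) set set \<Rightarrow> (real ^ 'n \<Rightarrow> real) \<Rightarrow> real ^ 'n \<Rightarrow> 'n rcall \<Rightarrow> bool" where
  "valid_call C c x r \<longleftrightarrow>
     constr r \<in> C \<and> x \<notin> constr r \<and>
     (\<forall>j\<in>vars (constr r). 0 \<le> prob r j \<and> prob r j \<le> 1) \<and>
     0 \<le> stepsize r \<and>
     (\<forall>j\<in>vars (constr r). 0 < prob r j \<longrightarrow>
        (\<exists>X. largest_raise c x j (stepsize r / prob r j) X)) \<and>
     set_pmf (raise_dist r) \<subseteq> Pow (vars (constr r)) \<and>
     (\<forall>j\<in>vars (constr r). measure_pmf.prob (raise_dist r) {A. j \<in> A} = prob r j)"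

definition rstep ::
    "(real ^ 'n::finite \<Rightarrow> real) \<Rightarrow> real ^ 'n \<Rightarrow> 'n rcall \<Rightarrow> 'n set \<Rightarrow> real ^ 'n" where
  "rstep c x r A = raise_to x (raise_target c x r) A"

(* The arbitrary choices of the algorithm are resolved by a strategy \<sigma>, which may use the whole
   history h, i.e. the list of sets of coordinates raised so far (the current vector is a function
   of h). In the least fixpoint, the mass missing from the subprobability distribution is the
   probability that the loop does not terminate. *)
partial_function (spmf) greedy_loop ::
    "(real ^ 'n::finite) set set \<Rightarrow> (real ^ 'n \<Rightarrow> real) \<Rightarrow> ('n set list \<Rightarrow> 'n rcall) \<Rightarrow>
     'n set list \<Rightarrow> real ^ 'n \<Rightarrow> (real ^ 'n) spmf" where
  "greedy_loop C c \<sigma> h x =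
     (if \<forall>S\<in>C. x \<in> S then return_spmf x
      else bind_pmf (raise_dist (\<sigma> h))
             (\<lambda>A. greedy_loop C c \<sigma> (h @ [A]) (rstep c x (\<sigma> h) A)))"

definition greedy ::
    "(real ^ 'n::finite) set set \<Rightarrow> (real ^ 'n \<Rightarrow> real) \<Rightarrow> ('n set list \<Rightarrow> 'n rcall) \<Rightarrow>
     (real ^ 'n) spmf" where
  "greedy C c \<sigma> = greedy_loop C c \<sigma> [] 0"

(* calls C c \<sigma> h x: with positive probability the run of the algorithm reaches history h with
   current vector x, and some constraint is still violated, so that rstep is called with the
   choices \<sigma> h. *)
inductive reached and calls ::
    "(real ^ 'n::finite) set set \<Rightarrow> (real ^ 'n \<Rightarrow> real) \<Rightarrow> ('n set list \<Rightarrow> 'n rcall) \<Rightarrow>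
     'n set list \<Rightarrow> real ^ 'n \<Rightarrow> bool"
  for C c \<sigma> where
  "reached C c \<sigma> [] 0"
| "reached C c \<sigma> h x \<Longrightarrow> \<exists>S\<in>C. x \<notin> S \<Longrightarrow> calls C c \<sigma> h x"
| "calls C c \<sigma> h x \<Longrightarrow> A \<in> set_pmf (raise_dist (\<sigma> h)) \<Longrightarrow>
     reached C c \<sigma> (h @ [A]) (rstep c x (\<sigma> h) A)"

end

theory Submission
  imports Defs
begin

text \<open>
  Fix a feasible \<open>z\<close> and let \<open>\<Phi>(x) = c(x \<squnion> z) - c(x) \<ge> 0\<close>. Submodularity bounds the
  expected cost increase of a call by \<open>\<Sum>\<^sub>j p\<^sub>j (\<beta> / p\<^sub>j) \<le> \<Delta> \<beta>\<close>, and bounds the decrease of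
  \<open>\<Phi>\<close> from \<open>x\<close> to \<open>x'\<close> from below by \<open>c(x' \<sqinter> (x \<squnion> z)) - c(x)\<close>. In expectation that is
  at least \<open>\<beta>\<close>: either every \<open>X\<^sub>j\<close> reaches \<open>z\<^sub>j\<close>, and then this is the hypothesis on the step
  size for \<open>x \<squnion> z \<in> S\<close>, or some \<open>X\<^sub>j < z\<^sub>j\<close>, and then raising \<open>x\<^sub>j\<close> alone contributes
  \<open>p\<^sub>j (\<beta> / p\<^sub>j)\<close>. So \<open>c + \<Delta> \<Phi>\<close> is a nonnegative supermartingale along the run, and it starts
  at \<open>c(0) + \<Delta> (c(z) - c(0)) \<le> \<Delta> c(z)\<close>.
\<close>

section \<open>Least fixpoints of subprobability distributions\<close>

text \<open>Monotone convergence: along a chain the densities increase pointwise to that of the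
  supremum. This makes upper bounds on integrals admissible in the fixpoint induction for the
  loop.\<close>

lemma nn_integral_lub_spmf:
  assumes chain: "Complete_Partial_Order.chain (ord_spmf (=)) Y" and Y: "Y \<noteq> {}"
  shows "(\<integral>\<^sup>+ x. f x \<partial>measure_spmf (lub_spmf Y)) = (SUP p\<in>Y. \<integral>\<^sup>+ x. f x \<partial>measure_spmf p)"
proof -
  \<comment> \<open>The chain need not be a sequence, but the support of the supremum is countable,
    and over a countable set monotone convergence holds for arbitrary chains.\<close>
  let ?M = "count_space (set_spmf (lub_spmf Y))"
  have "(\<integral>\<^sup>+ x. f x \<partial>measure_spmf (lub_spmf Y))
      = (\<integral>\<^sup>+ x. (SUP p\<in>Y. ennreal (spmf p x) * f x) \<partial>?M)"
    by (simp add: nn_integral_measure_spmf' ennreal_spmf_lub_spmf[OF chain Y]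
        SUP_mult_right_ennreal[symmetric])
  also have "\<dots> = (SUP p\<in>Y. \<integral>\<^sup>+ x. ennreal (spmf p x) * f x \<partial>?M)"
  proof (rule nn_integral_monotone_convergence_SUP_countable[OF Y])
    have "Complete_Partial_Order.chain (\<le>) ((\<lambda>g x. g x * f x) ` (\<lambda>p x. ennreal (spmf p x)) ` Y)"
      using chain_ord_spmf_eqD[OF chain]
      by (rule chain_imageI) (auto simp: le_fun_def intro: mult_right_mono)
    then show "Complete_Partial_Order.chain (\<le>) ((\<lambda>p x. ennreal (spmf p x) * f x) ` Y)"
      by (simp add: image_image)
  qed simp
  also have "\<dots> = (SUP p\<in>Y. \<integral>\<^sup>+ x. f x \<partial>measure_spmf p)"
    by (auto simp: nn_integral_measure_spmf nn_integral_count_space_indicator set_lub_spmf[OF chain]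
        spmf_eq_0_set_spmf split: split_indicator
        intro!: arg_cong[of _ _ Sup] image_cong nn_integral_cong)
  finally show ?thesis .
qed

lemma nn_integral_measure_spmf_bind_pmf:
  "(\<integral>\<^sup>+ y. f y \<partial>measure_spmf (bind_pmf p q)) = (\<integral>\<^sup>+ x. \<integral>\<^sup>+ y. f y \<partial>measure_spmf (q x) \<partial>measure_pmf p)"
  unfolding measure_spmf_bind_pmf o_def
  by (subst nn_integral_bind[where B="count_space UNIV"])
     (auto simp: measurable_def space_subprob_algebra intro: subprob_space_measure_spmf)

text \<open>A supermartingale rule with invariant \<open>I\<close>: \<open>B\<close> does not grow
  in expectation over an iteration and dominates \<open>g\<close> on exit. Fixpoint induction
  applies because mass lost to divergence adds nothing to the integral.\<close>

lemma greedy_loop_nn_integral_le: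
  assumes final: "\<And>h x. I h x \<Longrightarrow> \<forall>S\<in>C. x \<in> S \<Longrightarrow> g x \<le> B x"
    and preserved: "\<And>h x A. I h x \<Longrightarrow> \<not> (\<forall>S\<in>C. x \<in> S) \<Longrightarrow> A \<in> set_pmf (raise_dist (\<sigma> h)) \<Longrightarrow>
           I (h @ [A]) (rstep c x (\<sigma> h) A)"
    and step: "\<And>h x. I h x \<Longrightarrow> \<not> (\<forall>S\<in>C. x \<in> S) \<Longrightarrow>
           (\<integral>\<^sup>+ A. B (rstep c x (\<sigma> h) A) \<partial>measure_pmf (raise_dist (\<sigma> h))) \<le> B x"
    and "I h x"
  shows "(\<integral>\<^sup>+ y. g y \<partial>measure_spmf (greedy_loop C c \<sigma> h x)) \<le> B x"
proof -
  let ?P = "\<lambda>loop. \<forall>h x. I h x \<longrightarrow> (\<integral>\<^sup>+ y. g y \<partial>measure_spmf (loop C c \<sigma> h x)) \<le> B x"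
  have "?P greedy_loop"
  proof (rule greedy_loop.fixp_induct[where P="?P"], goal_cases)
    case 1
    have "ccpo.admissible lub_spmf (ord_spmf (=)) (\<lambda>p. (\<integral>\<^sup>+ y. g y \<partial>measure_spmf p) \<le> b)" for b
      by (rule ccpo.admissibleI) (simp add: nn_integral_lub_spmf SUP_le_iff)
    then have "spmf.admissible (\<lambda>f. (\<integral>\<^sup>+ y. g y \<partial>measure_spmf (f a)) \<le> b)" for a b
      by (rule admissible_subst[OF _ mcont_call])
    then show ?case
      by (intro admissible_all admissible_imp) simp
  next
    case 2
    then show ?case by (simp add: nn_integral_measure_spmf)
  next
    case (3 loop)
    show ?case
    proof (intro allI impI)
      fix h x
      assume I: "I h x"
      show "(\<integral>\<^sup>+ y. g y \<partial>measure_spmf (if \<forall>S\<in>C. x \<in> S then return_spmf x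
          else bind_pmf (raise_dist (\<sigma> h)) (\<lambda>A. loop C c \<sigma> (h @ [A]) (rstep c x (\<sigma> h) A)))) \<le> B x"
      proof (cases "\<forall>S\<in>C. x \<in> S")
        case True
        then show ?thesis
          using final[OF I] by (simp add: measure_spmf_return_spmf nn_integral_return)
      next
        case False
        have "(\<integral>\<^sup>+ A. \<integral>\<^sup>+ y. g y \<partial>measure_spmf (loop C c \<sigma> (h @ [A]) (rstep c x (\<sigma> h) A))
                \<partial>measure_pmf (raise_dist (\<sigma> h)))
            \<le> (\<integral>\<^sup>+ A. B (rstep c x (\<sigma> h) A) \<partial>measure_pmf (raise_dist (\<sigma> h)))"
          using 3 preserved[OF I False] by (intro nn_integral_mono_AE) (simp add: AE_measure_pmf_iff)
        also have "\<dots> \<le> B x"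
          using step[OF I False] .
        finally show ?thesis
          unfolding if_not_P[OF False] nn_integral_measure_spmf_bind_pmf .
      qed
    qed
  qed
  then show ?thesis using assms(4) by blast
qed

section \<open>A single call\<close>

lemma set_coord_nonneg:
  fixes x :: "real ^ 'n::finite"
  shows "0 \<le> x \<Longrightarrow> x $ j \<le> v \<Longrightarrow> 0 \<le> set_coord x j v"
  by (auto simp: less_eq_vec_def set_coord_def intro: order_trans)

lemma raise_to_ge:
  fixes x :: "real ^ 'n::finite"
  shows "(\<And>j. j \<in> A \<Longrightarrow> x $ j \<le> y $ j) \<Longrightarrow> x \<le> raise_to x y A"
  by (auto simp: less_eq_vec_def raise_to_def)

text \<open>Diminishing returns: when \<open>j\<close> joins \<open>A\<close>, the vector raised on
  \<open>A\<close> and the one raised in \<open>j\<close> alone have meet \<open>x\<close> and join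
  the new vector.\<close>

lemma submodular_raise_to_le_sum:
  fixes x :: "real ^ 'n::finite"
  assumes "submodular c" and x: "0 \<le> x" and "finite A" and "\<And>j. j \<in> A \<Longrightarrow> x $ j \<le> y $ j"
  shows "c (raise_to x y A) - c x \<le> (\<Sum>j\<in>A. c (set_coord x j (y $ j)) - c x)"
  using assms(3,4)
proof (induction A rule: finite_induct)
  case empty
  have "raise_to x y {} = x" by (simp add: raise_to_def vec_eq_iff)
  then show ?case by simp
next
  case (insert j A)
  have sup: "sup (raise_to x y A) (set_coord x j (y $ j)) = raise_to x y (insert j A)"
    using insert by (auto simp: vec_eq_iff sup_vec_def raise_to_def set_coord_def sup_real_def max_def
        intro: order_antisym)
  have inf: "inf (raise_to x y A) (set_coord x j (y $ j)) = x"
    using insert by (auto simp: vec_eq_iff inf_vec_def raise_to_def set_coord_def inf_real_def min_def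
        intro: order_antisym)
  have "0 \<le> raise_to x y A"
    using x raise_to_ge[of A x y] insert.prems by (auto intro: order_trans)
  moreover have "0 \<le> set_coord x j (y $ j)"
    using x insert.prems by (simp add: set_coord_nonneg)
  ultimately have "c x + c (raise_to x y (insert j A)) \<le> c (raise_to x y A) + c (set_coord x j (y $ j))"
    using \<open>submodular c\<close> sup inf unfolding submodular_def by metis
  then show ?case using insert by simp
qed

text \<open>By maximality every \<open>v\<close> above \<open>X\<close> exceeds the budget
  \<open>b\<close>; letting \<open>v\<close> decrease to \<open>X\<close> shows that the largest
  raise spends all of \<open>b\<close>.\<close>

lemma largest_raise_cost_ge:
  fixes c :: "real ^ 'n::finite \<Rightarrow> real"
  assumes right_cont: "\<And>x j. 0 \<le> x \<Longrightarrow> continuous (at_right (x $ j)) (\<lambda>v. c (set_coord x j v))"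
    and x: "0 \<le> x" and X: "largest_raise c x j b X"
  shows "b \<le> c (set_coord x j X) - c x"
proof -
  let ?x = "set_coord x j X"
  \<comment> \<open>\<open>right_cont\<close> speaks of the current value of a coordinate, so it is
    applied at the raised vector, whose coordinate \<open>j\<close> is \<open>X\<close>.\<close>
  have "continuous (at_right (?x $ j)) (\<lambda>v. c (set_coord ?x j v))"
    using X x by (intro right_cont set_coord_nonneg) (simp_all add: largest_raise_def)
  moreover have "set_coord ?x j v = set_coord x j v" for v
    by (simp add: set_coord_def vec_eq_iff)
  ultimately have "((\<lambda>v. c (set_coord x j v)) \<longlongrightarrow> c ?x) (at_right X)"
    by (simp add: continuous_within) (simp add: set_coord_def)
  moreover have "\<forall>\<^sub>F v in at_right X. c x + b \<le> c (set_coord x j v)"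
    using eventually_at_right_less[of X]
  proof eventually_elim
    case (elim v)
    moreover from this have "x $ j \<le> v" using X by (simp add: largest_raise_def)
    ultimately have "\<not> c (set_coord x j v) - c x \<le> b"
      using X unfolding largest_raise_def by (meson not_le)
    then show ?case by simp
  qed
  ultimately have "c x + b \<le> c ?x"
    by (rule tendsto_lowerbound) simp
  then show ?thesis by simp
qed

text \<open>A set in the support that contains \<open>j\<close> gives the event of raising
  \<open>j\<close> positive mass, so every target actually used has a positive denominator.\<close>

lemma valid_call_raised:
  assumes "valid_call C c x r" and "A \<in> set_pmf (raise_dist r)" and "j \<in> A"
  shows "j \<in> vars (constr r)" and "0 < prob r j"
proof -
  show j: "j \<in> vars (constr r)"
    using assms unfolding valid_call_def by blast
  have "0 < measure_pmf.prob (raise_dist r) {A. j \<in> A}"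
    using assms(2,3) by (intro measure_pmf_posI) auto
  then show "0 < prob r j"
    using assms(1) j by (simp add: valid_call_def)
qed

text \<open>Validity provides a largest value and antisymmetry makes it unique, so the definite
  description in \<open>raise_target\<close> denotes it.\<close>

lemma valid_call_largest_raise:
  assumes "valid_call C c x r" and "j \<in> vars (constr r)" and "0 < prob r j"
  shows "largest_raise c x j (stepsize r / prob r j) (raise_target c x r $ j)"
proof -
  obtain X where X: "largest_raise c x j (stepsize r / prob r j) X"
    using assms unfolding valid_call_def by blast
  then have "(THE X. largest_raise c x j (stepsize r / prob r j) X) = X"
    by (intro the_equality) (auto simp: largest_raise_def intro: order_antisym)
  then show ?thesis using X by (simp add: raise_target_def)
qed

lemma rstep_ge:
  fixes x :: "real ^ 'n::finite"
  assumes "valid_call C c x r" and "A \<in> set_pmf (raise_dist r)"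
  shows "x \<le> rstep c x r A"
  unfolding rstep_def
  using valid_call_largest_raise[OF assms(1) valid_call_raised[OF assms]]
  by (intro raise_to_ge) (simp add: largest_raise_def)

text \<open>Used at the finite type \<open>'n set\<close>, where every expectation over one call is
  a finite sum.\<close>

lemma integrable_pmf_finite_type [simp]:
  fixes f :: "'a::finite \<Rightarrow> real"
  shows "integrable (measure_pmf p) f"
  by (rule integrable_measure_pmf_finite) simp

text \<open>Submodularity reduces to single raises: raising \<open>j\<close> costs at most
  \<open>stepsize r / prob r j\<close> and has probability \<open>prob r j\<close>. Linearity of
  expectation involves only these marginals, so dependent raise events are covered.\<close>

lemma expected_cost_increase:
  fixes x :: "real ^ 'n::finite"
  assumes "submodular c" and x: "0 \<le> x" and valid: "valid_call C c x r"
  shows "measure_pmf.expectation (raise_dist r) (\<lambda>A. c (rstep c x r A) - c x)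
           \<le> real (card (vars (constr r))) * stepsize r"
proof -
  let ?V = "vars (constr r)" and ?E = "measure_pmf.expectation (raise_dist r)"
  let ?d = "\<lambda>j. c (set_coord x j (raise_target c x r $ j)) - c x"
  have "?E (\<lambda>A. c (rstep c x r A) - c x) \<le> ?E (\<lambda>A. \<Sum>j\<in>?V. ?d j * indicator {A. j \<in> A} A)"
  proof (rule integral_mono_AE)
    have "c (rstep c x r A) - c x \<le> (\<Sum>j\<in>?V. ?d j * indicator {A. j \<in> A} A)"
      if A: "A \<in> set_pmf (raise_dist r)" for A
    proof -
      have "c (rstep c x r A) - c x \<le> (\<Sum>j\<in>A. ?d j)"
        unfolding rstep_def
        using valid_call_largest_raise[OF valid valid_call_raised[OF valid A]]
        by (intro submodular_raise_to_le_sum assms) (auto simp: largest_raise_def)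
      also have "\<dots> = (\<Sum>j\<in>?V. ?d j * indicator {A. j \<in> A} A)"
        using valid_call_raised(1)[OF valid A] by (intro sum.mono_neutral_cong_left) auto
      finally show ?thesis .
    qed
    then show "AE A in measure_pmf (raise_dist r).
        c (rstep c x r A) - c x \<le> (\<Sum>j\<in>?V. ?d j * indicator {A. j \<in> A} A)"
      by (simp add: AE_measure_pmf_iff)
  qed simp_all
  also have "\<dots> = (\<Sum>j\<in>?V. ?E (\<lambda>A. ?d j * indicator {A. j \<in> A} A))"
    by (rule Bochner_Integration.integral_sum) simp
  also have "\<dots> = (\<Sum>j\<in>?V. ?d j * prob r j)"
    using valid by (simp add: valid_call_def)
  also have "\<dots> \<le> (\<Sum>j\<in>?V. stepsize r)"
  proof (rule sum_mono)
    fix j assume j: "j \<in> ?V"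
    show "?d j * prob r j \<le> stepsize r"
    proof (cases "0 < prob r j")
      case True
      then show ?thesis
        using valid_call_largest_raise[OF valid j] by (simp add: largest_raise_def pos_le_divide_eq)
    next
      \<comment> \<open>A coordinate of probability zero has no guaranteed largest raise, but its
        term is multiplied by zero.\<close>
      case False
      then have "prob r j = 0" using valid j by (force simp: valid_call_def)
      then show ?thesis using valid by (simp add: valid_call_def)
    qed
  qed
  finally show ?thesis by simp
qed

text \<open>Capping the new vector at \<open>sup x z\<close> isolates the part of the raise that
  makes progress towards \<open>z\<close>. The step-size hypothesis is used with
  \<open>sup x z\<close> as the vector to be reached.\<close>

lemma expected_potential_decrease:
  fixes x z :: "real ^ 'n::finite"
  assumes covering: "monotone_covering C c"
    and right_cont: "\<And>x j. 0 \<le> x \<Longrightarrow> continuous (at_right (x $ j)) (\<lambda>v. c (set_coord x j v))"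
    and x: "0 \<le> x" and valid: "valid_call C c x r" and z: "feasible C z"
    and stepsize_le: "\<And>y. x \<le> y \<Longrightarrow> y \<in> constr r \<Longrightarrow>
        stepsize r \<le> measure_pmf.expectation (raise_dist r) (\<lambda>A. c (raise_to x y A) - c x)"
  shows "stepsize r \<le> measure_pmf.expectation (raise_dist r)
      (\<lambda>A. (c (sup x z) - c x) - (c (sup (rstep c x r A) z) - c (rstep c x r A)))"
proof -
  let ?E = "measure_pmf.expectation (raise_dist r)"
  let ?X = "raise_target c x r" and ?x = "rstep c x r" and ?V = "vars (constr r)"
  have mono: "c u \<le> c v" if "0 \<le> u" "u \<le> v" for u v
    using covering that by (auto simp: monotone_covering_def)
  have ge: "x $ j \<le> ?X $ j" if "j \<in> ?V" "0 < prob r j" for j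
    using valid_call_largest_raise[OF valid that] by (simp add: largest_raise_def)
  have "?E (\<lambda>A. c (inf (?x A) (sup x z)) - c x)
      \<le> ?E (\<lambda>A. (c (sup x z) - c x) - (c (sup (?x A) z) - c (?x A)))"
  proof (rule integral_mono_AE)
    have "c (inf (?x A) (sup x z)) - c x
        \<le> (c (sup x z) - c x) - (c (sup (?x A) z) - c (?x A))"
      if A: "A \<in> set_pmf (raise_dist r)" for A
    proof -
      have xA: "x \<le> ?x A" using rstep_ge[OF valid A] .
      \<comment> \<open>Since \<open>x\<close> is below \<open>?x A\<close>, the join in the
        submodular inequality is the one in the new potential.\<close>
      then have "sup (?x A) (sup x z) = sup (?x A) z"
        by (metis sup.absorb1 sup_assoc)
      moreover have "0 \<le> ?x A" "0 \<le> sup x z"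
        using xA x by (auto intro: order_trans le_supI1)
      ultimately have "c (inf (?x A) (sup x z)) + c (sup (?x A) z) \<le> c (?x A) + c (sup x z)"
        using covering unfolding monotone_covering_def submodular_def by metis
      then show ?thesis by simp
    qed
    then show "AE A in measure_pmf (raise_dist r). c (inf (?x A) (sup x z)) - c x
        \<le> (c (sup x z) - c x) - (c (sup (?x A) z) - c (?x A))"
      by (simp add: AE_measure_pmf_iff)
  qed simp_all
  moreover have "stepsize r \<le> ?E (\<lambda>A. c (inf (?x A) (sup x z)) - c x)"
  proof (cases "\<exists>j\<in>?V. 0 < prob r j \<and> ?X $ j < z $ j")
    case True
    then obtain j where j: "j \<in> ?V" "0 < prob r j" "?X $ j < z $ j" by blast
    let ?d = "c (set_coord x j (?X $ j)) - c x"
    have "stepsize r = stepsize r / prob r j * prob r j"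
      using j by simp
    \<comment> \<open>By right-continuity the raise of \<open>j\<close> exhausts its budget.\<close>
    also have "\<dots> \<le> ?d * prob r j"
      using largest_raise_cost_ge[OF right_cont x valid_call_largest_raise[OF valid j(1,2)]] j
      by (intro mult_right_mono) auto
    also have "\<dots> = ?E (\<lambda>A. ?d * indicator {A. j \<in> A} A)"
      using valid j by (simp add: valid_call_def)
    also have "\<dots> \<le> ?E (\<lambda>A. c (inf (?x A) (sup x z)) - c x)"
    proof (rule integral_mono_AE)
      \<comment> \<open>As \<open>?X $ j < z $ j\<close>, the cap keeps the whole raise of
        \<open>j\<close> if \<open>j\<close> is in \<open>A\<close>; otherwise the capped vector is
        still above \<open>x\<close>, so the difference is nonnegative.\<close>
      have "?d * indicator {A. j \<in> A} A \<le> c (inf (?x A) (sup x z)) - c x"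
        if A: "A \<in> set_pmf (raise_dist r)" for A
      proof (cases "j \<in> A")
        case True
        have "set_coord x j (?X $ j) \<le> inf (?x A) (sup x z)"
          using True j rstep_ge[OF valid A]
          by (auto simp: less_eq_vec_def set_coord_def inf_vec_def sup_vec_def rstep_def raise_to_def
              le_max_iff_disj sup_real_def split: if_splits)
        then show ?thesis
          using True mono[of "set_coord x j (?X $ j)"] set_coord_nonneg[OF x ge[OF j(1,2)]] by simp
      next
        case False
        have "x \<le> inf (?x A) (sup x z)" using rstep_ge[OF valid A] by simp
        then show ?thesis using False mono[OF x] by simp
      qed
      then show "AE A in measure_pmf (raise_dist r).
          ?d * indicator {A. j \<in> A} A \<le> c (inf (?x A) (sup x z)) - c x"
        by (simp add: AE_measure_pmf_iff)
    qed simp_all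
    finally show ?thesis .
  next
    case False
    have "z \<in> constr r" "monotone_set (constr r)"
      using z valid covering by (auto simp: feasible_def valid_call_def monotone_covering_def)
    then have "sup x z \<in> constr r"
      unfolding monotone_set_def by (meson sup_ge2)
    then have "stepsize r \<le> ?E (\<lambda>A. c (raise_to x (sup x z) A) - c x)"
      by (intro stepsize_le) simp_all
    also have "\<dots> = ?E (\<lambda>A. c (inf (?x A) (sup x z)) - c x)"
    proof (rule integral_cong_AE)
      \<comment> \<open>No raised coordinate stops short of \<open>z\<close>, so the cap replaces
        each target by the coordinate of \<open>sup x z\<close>.\<close>
      have "raise_to x (sup x z) A = inf (?x A) (sup x z)"
        if A: "A \<in> set_pmf (raise_dist r)" for A
      proof -
        have "x $ j \<le> ?X $ j \<and> z $ j \<le> ?X $ j" if "j \<in> A" for j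
          using False ge valid_call_raised[OF valid A that] by (meson not_le)
        then show ?thesis
          by (auto simp: vec_eq_iff raise_to_def rstep_def inf_vec_def sup_vec_def inf_real_def sup_real_def)
      qed
      then show "AE A in measure_pmf (raise_dist r).
          c (raise_to x (sup x z) A) - c x = c (inf (?x A) (sup x z)) - c x"
        by (simp add: AE_measure_pmf_iff)
    qed simp_all
    finally show ?thesis .
  qed
  ultimately show ?thesis by linarith
qed

lemma card_vars_le_Delta:
  fixes C :: "(real ^ 'n::finite) set set"
  assumes "S \<in> C"
  shows "card (vars S) \<le> Delta C"
  unfolding Delta_def using assms
  by (intro cSUP_upper bdd_aboveI2[where M="CARD('n)"]) (auto intro: card_mono)

lemma reached_nonneg:
  fixes C :: "(real ^ 'n::finite) set set"
  assumes valid: "\<And>h x. calls C c \<sigma> h x \<Longrightarrow> valid_call C c x (\<sigma> h)"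
    and "reached C c \<sigma> h x"
  shows "0 \<le> x"
proof -
  have "(reached C c \<sigma> h x \<longrightarrow> 0 \<le> x) \<and> (calls C c \<sigma> h x \<longrightarrow> 0 \<le> x)"
    by (rule reached_calls.induct) (auto intro: order_trans rstep_ge[OF valid])
  then show ?thesis using assms(2) by blast
qed

section \<open>The whole run\<close>

text \<open>The supermartingale rule with the indicator of infeasibility and bound zero: on exit all
  constraints hold, and \<open>reached\<close> supplies nonnegativity.\<close>

lemma greedy_set_spmf_feasible:
  fixes C :: "(real ^ 'n::finite) set set"
  assumes valid: "\<And>h x. calls C c \<sigma> h x \<Longrightarrow> valid_call C c x (\<sigma> h)"
    and y: "y \<in> set_spmf (greedy C c \<sigma>)"
  shows "feasible C y"
proof -
  have "(\<integral>\<^sup>+ y. indicator (- Collect (feasible C)) y \<partial>measure_spmf (greedy_loop C c \<sigma> [] 0)) \<le> 0"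
    by (rule greedy_loop_nn_integral_le[where I="reached C c \<sigma>" and B="\<lambda>_. 0"])
       (auto intro: reached_calls.intros simp: feasible_def reached_nonneg[OF valid])
  then have "emeasure (measure_spmf (greedy C c \<sigma>)) (- Collect (feasible C)) = 0"
    by (simp add: greedy_def)
  then have "AE y in measure_spmf (greedy C c \<sigma>). feasible C y"
    by (intro AE_I[where N="- Collect (feasible C)"]) auto
  then show ?thesis using y by simp
qed

lemma greedy_nn_integral_le:
  fixes C :: "(real ^ 'n::finite) set set"
  assumes covering: "monotone_covering C c"
    and right_cont: "\<And>x j. 0 \<le> x \<Longrightarrow> continuous (at_right (x $ j)) (\<lambda>v. c (set_coord x j v))"
    and nondegenerate: "0 < Delta C \<or> c 0 = 0"
    and valid: "\<And>h x. calls C c \<sigma> h x \<Longrightarrow> valid_call C c x (\<sigma> h)"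
    and stepsize_le: "\<And>h x y. calls C c \<sigma> h x \<Longrightarrow> x \<le> y \<Longrightarrow> y \<in> constr (\<sigma> h) \<Longrightarrow>
           stepsize (\<sigma> h)
             \<le> measure_pmf.expectation (raise_dist (\<sigma> h)) (\<lambda>A. c (raise_to x y A) - c x)"
    and z: "feasible C z"
  shows "(\<integral>\<^sup>+ y. ennreal (c y) \<partial>measure_spmf (greedy C c \<sigma>)) \<le> ennreal (real (Delta C) * c z)"
proof -
  let ?D = "real (Delta C)"
  let ?\<Phi> = "\<lambda>x. c (sup x z) - c x"
  \<comment> \<open>The weight \<open>?D\<close> is the exchange rate: in expectation a call adds at
    most \<open>?D\<close> step sizes to the cost and removes at least one from the
    potential.\<close>
  let ?b = "\<lambda>x. c x + ?D * ?\<Phi> x"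
  have \<Phi>_nonneg: "0 \<le> ?\<Phi> x" if "0 \<le> x" for x
    using covering that by (simp add: monotone_covering_def)
  have c_nonneg: "0 \<le> c x" if "0 \<le> x" for x
    using covering that by (simp add: monotone_covering_def)
  have step: "(\<integral>\<^sup>+ A. ennreal (?b (rstep c x (\<sigma> h) A)) \<partial>measure_pmf (raise_dist (\<sigma> h))) \<le> ennreal (?b x)"
    if reached: "reached C c \<sigma> h x" and viol: "\<exists>S\<in>C. x \<notin> S" for h x
  proof -
    have calls: "calls C c \<sigma> h x"
      using that by (rule reached_calls.intros)
    let ?r = "\<sigma> h"
    let ?E = "measure_pmf.expectation (raise_dist ?r)" and ?x = "rstep c x ?r"
    have x: "0 \<le> x" using valid reached by (rule reached_nonneg)
    have v: "valid_call C c x ?r" using calls by (rule valid)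
    have "0 \<le> ?x A" if "A \<in> set_pmf (raise_dist ?r)" for A
      using x rstep_ge[OF v that] by (rule order_trans)
    then have "(\<integral>\<^sup>+ A. ennreal (?b (?x A)) \<partial>measure_pmf (raise_dist ?r)) = ennreal (?E (\<lambda>A. ?b (?x A)))"
      using c_nonneg \<Phi>_nonneg
      by (intro nn_integral_eq_integral) (auto simp: AE_measure_pmf_iff intro!: add_nonneg_nonneg mult_nonneg_nonneg)
    also have "?E (\<lambda>A. ?b (?x A)) = ?b x + ?E (\<lambda>A. c (?x A) - c x) - ?D * ?E (\<lambda>A. ?\<Phi> x - ?\<Phi> (?x A))"
      by (simp add: algebra_simps)
    also have "\<dots> \<le> ?b x"
    proof -
      have "?E (\<lambda>A. c (?x A) - c x) \<le> real (card (vars (constr ?r))) * stepsize ?r"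
        using covering x v by (intro expected_cost_increase) (auto simp: monotone_covering_def)
      also have "\<dots> \<le> ?D * stepsize ?r"
        using v card_vars_le_Delta[of "constr ?r" C]
        by (intro mult_right_mono) (auto simp: valid_call_def)
      also have "\<dots> \<le> ?D * ?E (\<lambda>A. ?\<Phi> x - ?\<Phi> (?x A))"
        by (intro mult_left_mono expected_potential_decrease[OF covering right_cont x v z]
            stepsize_le[OF calls]) auto
      finally show ?thesis by simp
    qed
    finally show ?thesis by (simp add: ennreal_leI)
  qed
  have "(\<integral>\<^sup>+ y. ennreal (c y) \<partial>measure_spmf (greedy_loop C c \<sigma> [] 0)) \<le> ennreal (?b 0)"
  proof (rule greedy_loop_nn_integral_le[where I="reached C c \<sigma>"])
    show "ennreal (c x) \<le> ennreal (?b x)" if "reached C c \<sigma> h x" for h x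
      using \<Phi>_nonneg[OF reached_nonneg[OF valid that]] by (intro ennreal_leI) simp
  qed (auto intro: reached_calls.intros step)
  also have "?b 0 \<le> ?D * c z"
  proof -
    have z0: "sup 0 z = z" using z by (simp add: feasible_def sup.absorb2)
    \<comment> \<open>This is where \<open>nondegenerate\<close> enters: for \<open>C = {}\<close>
      and \<open>c 0 > 0\<close> the run returns \<open>0\<close> at positive cost although
      \<open>Delta C = 0\<close>.\<close>
    have "c 0 \<le> ?D * c 0"
    proof (cases "c 0 = 0")
      case False
      then have "1 \<le> ?D" using nondegenerate by simp
      then show ?thesis using c_nonneg[of 0] by (simp add: mult_right_mono[of 1 ?D "c 0", simplified])
    qed simp
    then show ?thesis by (simp add: z0 algebra_simps)
  qed
  finally show ?thesis by (simp add: greedy_def ennreal_leI)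
qed

theorem theorem6:
  fixes C :: "(real ^ 'n::finite) set set"
    and c :: "real ^ 'n \<Rightarrow> real"
    and \<sigma> :: "'n set list \<Rightarrow> 'n rcall"
  assumes "monotone_covering C c"
    and right_cont: "\<And>x j. 0 \<le> x \<Longrightarrow> continuous (at_right (x $ j)) (\<lambda>v. c (set_coord x j v))"
    and nondegenerate: "0 < Delta C \<or> c 0 = 0"
    and "\<And>h x. calls C c \<sigma> h x \<Longrightarrow> valid_call C c x (\<sigma> h)"
    and "\<And>h x y. calls C c \<sigma> h x \<Longrightarrow> x \<le> y \<Longrightarrow> y \<in> constr (\<sigma> h) \<Longrightarrow>
           stepsize (\<sigma> h)
             \<le> measure_pmf.expectation (raise_dist (\<sigma> h)) (\<lambda>A. c (raise_to x y A) - c x)"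
    and terminates: "lossless_spmf (greedy C c \<sigma>)"
  shows "(\<forall>x\<in>set_spmf (greedy C c \<sigma>). feasible C x) \<and>
         integrable (measure_spmf (greedy C c \<sigma>)) c \<and>
         integral\<^sup>L (measure_spmf (greedy C c \<sigma>)) c \<le> real (Delta C) * OPT C c"
proof -
  let ?M = "measure_spmf (greedy C c \<sigma>)"
  let ?D = "real (Delta C)"
  have feas: "feasible C x" if "x \<in> set_spmf (greedy C c \<sigma>)" for x
    using assms(4) that by (rule greedy_set_spmf_feasible)
  have c_nonneg: "0 \<le> c x" if "feasible C x" for x
    using assms(1) that by (simp add: monotone_covering_def feasible_def)
  have AE: "AE x in ?M. 0 \<le> c x"
    using feas c_nonneg by simp
  have le: "(\<integral>\<^sup>+ y. ennreal (c y) \<partial>?M) \<le> ennreal (?D * c z)" if "feasible C z" for z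
    by (rule greedy_nn_integral_le[OF assms(1-5) that])
  \<comment> \<open>Termination provides the witness: a lossless distribution has an outcome, and
    every outcome is feasible.\<close>
  obtain z where z: "feasible C z"
    using terminates feas measure_spmf_zero_iff[of "greedy C c \<sigma>" UNIV]
    by (auto simp: lossless_spmf_def weight_spmf_def)
  have integrable: "integrable ?M c"
    using AE le[OF z] by (intro integrableI_nonneg) (auto simp: le_less_trans)
  have bound: "integral\<^sup>L ?M c \<le> ?D * c z" if "feasible C z" for z
  proof -
    have "ennreal (integral\<^sup>L ?M c) \<le> ennreal (?D * c z)"
      using le[OF that] nn_integral_eq_integral[OF integrable AE] by simp
    then show ?thesis using c_nonneg[OF that] by simp
  qed
  have "integral\<^sup>L ?M c \<le> ?D * OPT C c"
  \<comment> \<open>Dividing by \<open>?D\<close> makes the bound a lower bound on all feasible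
    costs, hence on their infimum. For \<open>?D = 0\<close> the bound at \<open>z\<close> is
    already zero.\<close>
  proof (cases "Delta C = 0")
    case True
    then show ?thesis using bound[OF z] by simp
  next
    case False
    have "integral\<^sup>L ?M c / ?D \<le> OPT C c"
      unfolding OPT_def using z bound False
      by (intro cInf_greatest) (auto simp: pos_divide_le_eq mult.commute)
    then show ?thesis using False by (simp add: pos_divide_le_eq mult.commute)
  qed
  then show ?thesis using feas integrable by blast
qed

end
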